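(* Let $m \geq 2$ be an integer and let $S$ be a minimal zero-sum multiset in $\mathbb{Z}/m\mathbb{Z}$. (i) If $\#S + \sigma(S) = m+1$, then $\sigma(S) \leq 2$, except when $m = 6$ and $S$ is the multiset $(1,3,4,4)$ or the multiset $(2,2,3,5)$ (of residue classes mod $6$). (ii) If $m \geq 3$, $m \neq 6$, and $\#S + \sigma(S) = m+1$, then $S$ contains an element $a$ of multiplicity $\mu(a) \geq m-2$. (iii) If $m \geq 7$ and $\sigma(S) \geq 3$, then $\#S \leq m - \sigma(S)$.
   Context: A finite multiset $S$ in an abelian group $M$ consists of a finite support $\operatorname{supp}(S) \subseteq M$ and a multiplicity $\mu(a) \geq 1$ for each $a \in \operatorname{supp}(S)$. Its sum is $\Sigma(S) = \sum_{a \in \operatorname{supp}(S)} \mu(a)\, a \in M$, its size is $\#S = \sum_{a \in \operatorname{supp}(S)} \mu(a)$ (elements counted with multiplicity), and its width is $\sigma(S) = \#\operatorname{supp}(S)$ (number of different elements). $S$ is a zero-sum multiset if $\Sigma(S) = 0$; it is a minimal zero-sum multiset if it is a nonempty zero-sum multiset and no proper nonempty submultiset has sum zero. *)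

theory Defs
  imports "HOL-Algebra.Elementary_Groups" "HOL-Algebra.FiniteProduct" "HOL-Library.Multiset"
begin

text \<open>
  Groups are written multiplicatively in HOL-Algebra, so the additive sum
  \<open>\<Sum>\<^sub>a \<mu>(a) a\<close> over the support becomes a \<^const>\<open>finprod\<close> of powers,
  and zero becomes the neutral element. It is meaningful only for multisets supported in the carrier.
\<close>

definition msum :: "('a, 'b) monoid_scheme \<Rightarrow> 'a multiset \<Rightarrow> 'a" where
  "msum M S = finprod M (\<lambda>a. a [^]\<^bsub>M\<^esub> count S a) (set_mset S)"

definition width :: "'a multiset \<Rightarrow> nat" where
  "width S = card (set_mset S)"

definition zero_sum :: "('a, 'b) monoid_scheme \<Rightarrow> 'a multiset \<Rightarrow> bool" where
  "zero_sum M S \<longleftrightarrow> set_mset S \<subseteq> carrier M \<and> msum M S = \<one>\<^bsub>M\<^esub>"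

definition minimal_zero_sum :: "('a, 'b) monoid_scheme \<Rightarrow> 'a multiset \<Rightarrow> bool" where
  "minimal_zero_sum M S \<longleftrightarrow>
     S \<noteq> {#} \<and> zero_sum M S \<and> (\<forall>T. T \<subset># S \<and> T \<noteq> {#} \<longrightarrow> \<not> zero_sum M T)"

end

theory Submission
  imports Defs
begin

text \<open>
  For a zero-sum free \<open>T\<close>, removing an element always loses the subsum \<open>\<Sum> T\<close>, and of any two
  distinct elements the removal of at least one loses two subsums: otherwise the remaining
  subsums would be the same for both and invariant under their difference. Hence \<open>T\<close> has at
  least \<open>#T + \<sigma>(T)\<close> subsums, the empty one included. One more is gained when \<open>\<sigma>(T) \<ge> 3\<close> and
  \<open>#T \<ge> 4\<close>: three distinct elements have at least 7 subsums unless one of them has order two, and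
  an element of order two can be factored out, which halves the number of subsums. If some
  element of a minimal zero-sum \<open>S\<close> is repeated, removing one copy of it leaves the support
  unchanged, so this bounds \<open>#S + \<sigma>(S)\<close>; if none is, \<open>S\<close> and \<open>-S\<close> together already contain
  at least \<open>2 \<sigma>(S) - 1\<close> nonzero classes.
\<close>

section \<open>Subsums and zero-sum free multisets modulo \<open>m\<close>\<close>

text \<open>Elements are arbitrary integers rather than reduced residues, so that the same multiset
  can also be read modulo a divisor of \<open>m\<close>; the order-two case passes to
  \<open>m / 2\<close> in this way.\<close>

definition subsums :: "int \<Rightarrow> int multiset \<Rightarrow> int set" where
  "subsums m T = (\<lambda>U. \<Sum>\<^sub># U mod m) ` {U. U \<subseteq># T}"

definition zero_sum_free :: "int \<Rightarrow> int multiset \<Rightarrow> bool" where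
  "zero_sum_free m T \<longleftrightarrow> (\<forall>U. U \<subseteq># T \<longrightarrow> U \<noteq> {#} \<longrightarrow> \<not> m dvd \<Sum>\<^sub># U)"

lemma zero_sum_freeD: "zero_sum_free m T \<Longrightarrow> U \<subseteq># T \<Longrightarrow> U \<noteq> {#} \<Longrightarrow> \<not> m dvd \<Sum>\<^sub># U"
  by (auto simp: zero_sum_free_def)

lemma zero_sum_free_mono: "zero_sum_free m T \<Longrightarrow> T' \<subseteq># T \<Longrightarrow> zero_sum_free m T'"
  by (meson subset_mset.order_trans zero_sum_free_def)

lemma mem_subsums_iff: "v mod m \<in> subsums m T \<longleftrightarrow> (\<exists>U. U \<subseteq># T \<and> m dvd v - \<Sum>\<^sub># U)"
  by (auto simp: subsums_def image_iff mod_eq_dvd_iff)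

lemma mem_subsumsI: "U \<subseteq># T \<Longrightarrow> v = \<Sum>\<^sub># U \<Longrightarrow> v mod m \<in> subsums m T"
  by (auto simp: mem_subsums_iff)

lemma subsums_mono: "T' \<subseteq># T \<Longrightarrow> subsums m T' \<subseteq> subsums m T"
  by (auto simp: subsums_def intro: subset_mset.order_trans)

lemma finite_submultisets: "finite {U. U \<subseteq># T}"
proof (rule finite_subset)
  show "{U. U \<subseteq># T} \<subseteq> mset ` {xs. set xs \<subseteq> set_mset T \<and> length xs \<le> size T}"
  proof
    fix U assume "U \<in> {U. U \<subseteq># T}"
    then have U: "U \<subseteq># T" by simp
    obtain xs where xs: "mset xs = U" using ex_mset by blast
    have "set xs \<subseteq> set_mset T" using set_mset_mono[OF U] xs by auto
    moreover have "length xs \<le> size T" using size_mset_mono[OF U] xs by auto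
    ultimately show "U \<in> mset ` {xs. set xs \<subseteq> set_mset T \<and> length xs \<le> size T}"
      using xs by blast
  qed
qed (simp add: finite_lists_length_le)

lemma finite_subsums [simp]: "finite (subsums m T)"
  by (simp add: subsums_def finite_submultisets)

lemma card_subsums_le: "m > 0 \<Longrightarrow> card (subsums m T) \<le> nat m"
proof -
  assume "m > 0"
  then have "subsums m T \<subseteq> {0..<m}"
    by (auto simp: subsums_def)
  from card_mono[OF _ this] show ?thesis
    by simp
qed

text \<open>Allows counting by an explicit list of submultisets with pairwise incongruent sums;
  through \<open>sorted_wrt\<close> each pair is compared in one order only.\<close>

lemma card_subsums_ge:
  assumes "sorted_wrt (\<lambda>U V. \<not> m dvd \<Sum>\<^sub># V - \<Sum>\<^sub># U) Us" "\<And>U. U \<in> set Us \<Longrightarrow> U \<subseteq># T"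
  shows "length Us \<le> card (subsums m T)"
proof -
  have "distinct (map (\<lambda>U. \<Sum>\<^sub># U mod m) Us)"
    using assms(1) by (induction Us) (auto simp: mod_eq_dvd_iff dvd_diff_commute image_iff)
  then have "length Us = card ((\<lambda>U. \<Sum>\<^sub># U mod m) ` set Us)"
    using distinct_card by fastforce
  also have "\<dots> \<le> card (subsums m T)"
    using assms(2) by (intro card_mono finite_subsums) (auto simp: subsums_def)
  finally show ?thesis .
qed

lemma compl_subsums: "v mod m \<in> subsums m T \<longleftrightarrow> (\<Sum>\<^sub># T - v) mod m \<in> subsums m T"
proof -
  have "(\<Sum>\<^sub># T - v) mod m \<in> subsums m T" if "v mod m \<in> subsums m T" for v
  proof -
    obtain U where U: "U \<subseteq># T" "m dvd v - \<Sum>\<^sub># U"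
      using \<open>v mod m \<in> subsums m T\<close> by (auto simp: mem_subsums_iff)
    have "\<Sum>\<^sub># T = \<Sum>\<^sub># U + \<Sum>\<^sub># (T - U)"
      by (metis U(1) subset_mset.add_diff_inverse sum_mset.union)
    then have "\<Sum>\<^sub># T - v - \<Sum>\<^sub># (T - U) = - (v - \<Sum>\<^sub># U)"
      by simp
    then have "m dvd \<Sum>\<^sub># T - v - \<Sum>\<^sub># (T - U)"
      using U(2) by (metis dvd_minus_iff)
    then show ?thesis
      unfolding mem_subsums_iff by (intro exI[of _ "T - U"]) simp
  qed
  from this[of v] this[of "\<Sum>\<^sub># T - v"] show ?thesis
    by auto
qed

section \<open>Subsums lost by removing an element\<close>

text \<open>If some \<open>U\<close> without this copy of \<open>x\<close> had the full sum, its
  complement \<open>T - U\<close> would be nonempty with sum zero.\<close>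

lemma sum_notin_subsums_remove:
  assumes "zero_sum_free m T" "x \<in># T"
  shows "\<Sum>\<^sub># T mod m \<notin> subsums m (T - {#x#})"
proof
  assume "\<Sum>\<^sub># T mod m \<in> subsums m (T - {#x#})"
  then obtain U where U: "U \<subseteq># T - {#x#}" "m dvd \<Sum>\<^sub># T - \<Sum>\<^sub># U"
    by (auto simp: mem_subsums_iff)
  have "U \<subset># T"
    using U(1) assms(2) by (metis add_mset_remove_trivial_eq diff_subset_eq_self multi_self_add_other_not_self
      subset_mset.le_less_trans subset_mset.less_le insert_DiffM)
  then have "\<Sum>\<^sub># T = \<Sum>\<^sub># U + \<Sum>\<^sub># (T - U)" "T - U \<noteq> {#}"
    by (metis subset_mset.add_diff_inverse subset_mset.less_imp_le sum_mset.union,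
      metis Diff_eq_empty_iff_mset subset_mset.less_le_not_le)
  then show False
    using zero_sum_freeD[OF assms(1), of "T - U"] U(2) by simp
qed

lemma card_subsums_remove:
  assumes "zero_sum_free m T" "x \<in># T"
  shows "card (subsums m (T - {#x#})) < card (subsums m T)"
proof (rule psubset_card_mono)
  have "\<Sum>\<^sub># T mod m \<in> subsums m T"
    by (rule mem_subsumsI) auto
  then show "subsums m (T - {#x#}) \<subset> subsums m T"
    using sum_notin_subsums_remove[OF assms] subsums_mono[of "T - {#x#}" T m] by auto
qed simp

text \<open>Passing from \<open>T\<close> to \<open>T'\<close> one element at a time loses at least
  one subsum per removal. The additive form avoids subtraction on naturals.\<close>

lemma card_subsums_mono:
  assumes "zero_sum_free m T" "T' \<subseteq># T"
  shows "card (subsums m T') + size T \<le> card (subsums m T) + size T'"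
  using assms
proof (induction "size T" arbitrary: T)
  case 0
  then show ?case by simp
next
  case (Suc n)
  show ?case
  proof (cases "T' = T")
    case False
    then have "T - T' \<noteq> {#}"
      using Suc.prems by (metis Diff_eq_empty_iff_mset subset_mset.antisym)
    then obtain x where x: "x \<in># T - T'"
      by blast
    then have xT: "x \<in># T"
      by (meson in_diffD)
    have "T' \<subseteq># T - {#x#}"
      using x Suc.prems(2) by (auto simp: subseteq_mset_def in_diff_count)
    moreover have "size (T - {#x#}) = n"
      using Suc.hyps(2) xT by (simp add: size_Diff_singleton)
    ultimately have "card (subsums m T') + n \<le> card (subsums m (T - {#x#})) + size T'"
      using Suc.hyps(1)[of "T - {#x#}"] Suc.prems(1) by (metis diff_subset_eq_self zero_sum_free_mono)
    then show ?thesis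
      using card_subsums_remove[OF Suc.prems(1) xT] Suc.hyps(2) by linarith
  qed simp
qed

text \<open>If both removals lost only the full sum, they would leave the same set \<open>B\<close>,
  and translating \<open>B\<close> by \<open>x\<close> or by \<open>y\<close> would give the same
  set. Following \<open>x\<close> through these translations produces a submultiset containing
  \<open>y\<close> with sum zero.\<close>

lemma card_subsums_remove_either:
  assumes zsf: "zero_sum_free m T" and xy: "x \<in># T" "y \<in># T" "\<not> m dvd x - y"
  shows "\<exists>z \<in> {x, y}. card (subsums m (T - {#z#})) + 2 \<le> card (subsums m T)"
proof (rule ccontr)
  define \<sigma> where "\<sigma> = \<Sum>\<^sub># T"
  assume neg: "\<not> ?thesis"
  have eq: "subsums m (T - {#z#}) = subsums m T - {\<sigma> mod m}" if z: "z \<in> {x, y}" for z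
  proof (rule card_subset_eq)
    have zT: "z \<in># T" using z xy by auto
    show "subsums m (T - {#z#}) \<subseteq> subsums m T - {\<sigma> mod m}"
      using sum_notin_subsums_remove[OF zsf zT] subsums_mono[of "T - {#z#}" T m]
      by (auto simp: \<sigma>_def)
    have "card (subsums m (T - {#z#})) + 1 = card (subsums m T)"
      using neg z card_subsums_remove[OF zsf zT] by fastforce
    moreover have "\<sigma> mod m \<in> subsums m T"
      unfolding \<sigma>_def by (rule mem_subsumsI) auto
    ultimately show "card (subsums m (T - {#z#})) = card (subsums m T - {\<sigma> mod m})"
      by simp
  qed simp
  define B where "B = subsums m T - {\<sigma> mod m}"
  \<comment> \<open>By complementation both \<open>x + B\<close> and \<open>y + B\<close> are the set of subsums other than \<open>0\<close>.\<close>
  have shift: "v mod m \<in> subsums m T \<and> \<not> m dvd v \<longleftrightarrow> (v - z) mod m \<in> B" if z: "z \<in> {x, y}" for v z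
  proof -
    have zT: "z \<in># T" using z xy by auto
    \<comment> \<open>Complementing first in \<open>T - {#z#}\<close> and then in \<open>T\<close>
      amounts to a translation by \<open>z\<close>; the omitted full sum of \<open>T\<close> turns
      into the omitted class 0.\<close>
    have "(v - z) mod m \<in> B \<longleftrightarrow> (\<Sum>\<^sub># (T - {#z#}) - (v - z)) mod m \<in> B"
      using compl_subsums[of "v - z" m "T - {#z#}"] eq[OF z] by (simp add: B_def)
    also have "\<Sum>\<^sub># (T - {#z#}) - (v - z) = \<sigma> - v"
      using zT by (simp add: \<sigma>_def sum_mset_diff)
    also have "(\<sigma> - v) mod m \<in> B \<longleftrightarrow> v mod m \<in> subsums m T \<and> \<not> m dvd v"
      using compl_subsums[of v m T] by (auto simp: B_def \<sigma>_def mod_eq_dvd_iff)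
    finally show ?thesis by simp
  qed
  \<comment> \<open>Start at the nonzero subsum \<open>x\<close>. Shifting by \<open>y\<close> leads
    to \<open>x - y\<close>, which is nonzero by assumption; shifting this by \<open>x\<close> leads
    to \<open>-y\<close>. So \<open>-y\<close> is a subsum avoiding one copy of \<open>y\<close>,
    and putting that copy back gives zero.\<close>
  have "x mod m \<in> subsums m T \<and> \<not> m dvd x"
    using zero_sum_freeD[OF zsf, of "{#x#}"] xy(1) mem_subsumsI[of "{#x#}" T x m] by simp
  then have "(x - y) mod m \<in> B"
    using shift[of y x] by simp
  then have "(x - y) mod m \<in> subsums m T \<and> \<not> m dvd x - y"
    using xy(3) by (simp add: B_def)
  then have "(x - y - x) mod m \<in> subsums m (T - {#y#})"
    using shift[of x "x - y"] eq[of y] by (simp add: B_def)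
  then obtain U where U: "U \<subseteq># T - {#y#}" "m dvd x - y - x - \<Sum>\<^sub># U"
    unfolding mem_subsums_iff by blast
  have "x - y - x - \<Sum>\<^sub># U = - \<Sum>\<^sub># (add_mset y U)"
    by simp
  then have "m dvd \<Sum>\<^sub># (add_mset y U)"
    using U(2) by (metis dvd_minus_iff)
  moreover have "add_mset y U \<subseteq># T"
    using U(1) xy(2) by (metis insert_DiffM mset_subset_eq_add_mset_cancel)
  ultimately show False
    using zero_sum_freeD[OF zsf, of "add_mset y U"] by simp
qed


section \<open>Small multisets with seven subsums\<close>

text \<open>The sum \<open>b + c\<close> is left out of the list because the hypotheses allow it to
  coincide with \<open>a\<close>. Every other coincidence is excluded by them or would give a
  zero-sum submultiset.\<close>

lemma card_subsums_triple_aux: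
  assumes zsf: "zero_sum_free m {#a, b, c#}"
    and "\<not> m dvd a - b" "\<not> m dvd a - c" "\<not> m dvd b - c" "\<not> m dvd b - a - c" "\<not> m dvd c - a - b"
  shows "7 \<le> card (subsums m {#a, b, c#})"
proof -
  let ?Us = "[{#}, {#a#}, {#b#}, {#c#}, {#a, b#}, {#a, c#}, {#a, b, c#}]"
  note nz = zero_sum_freeD[OF zsf, of "{#a#}"] zero_sum_freeD[OF zsf, of "{#b#}"]
    zero_sum_freeD[OF zsf, of "{#c#}"] zero_sum_freeD[OF zsf, of "{#a, b#}"]
    zero_sum_freeD[OF zsf, of "{#a, c#}"] zero_sum_freeD[OF zsf, of "{#b, c#}"]
    zero_sum_freeD[OF zsf, of "{#a, b, c#}"]
  have "length ?Us \<le> card (subsums m {#a, b, c#})"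
  proof (rule card_subsums_ge)
    have "\<not> m dvd b - a" "\<not> m dvd c - a" "\<not> m dvd c - b" 
      "\<not> m dvd a + c - b" "\<not> m dvd a + b - c"
      using assms(2-) by (metis dvd_diff_commute diff_diff_eq)+
    then show "sorted_wrt (\<lambda>U V. \<not> m dvd \<Sum>\<^sub># V - \<Sum>\<^sub># U) ?Us"
      using nz assms(2-) by (simp add: algebra_simps)
  qed auto
  then show ?thesis by simp
qed

lemma card_subsums_triple:
  assumes zsf: "zero_sum_free m {#a, b, c#}"
    and ne: "\<not> m dvd a - b" "\<not> m dvd a - c" "\<not> m dvd b - c"
    and ord: "\<not> m dvd 2 * a" "\<not> m dvd 2 * b" "\<not> m dvd 2 * c"
  shows "7 \<le> card (subsums m {#a, b, c#})"
proof -
  \<comment> \<open>Two of the coincidences \<open>a = b + c\<close>, \<open>b = a + c\<close>, \<open>c = a + b\<close> would give an element of order two.\<close>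
  have "\<not> (m dvd a - b - c \<and> m dvd b - a - c)" "\<not> (m dvd a - b - c \<and> m dvd c - a - b)"
       "\<not> (m dvd b - a - c \<and> m dvd c - a - b)"
    using ord dvd_add[of m "a - b - c" "b - a - c"] dvd_add[of m "a - b - c" "c - a - b"]
      dvd_add[of m "b - a - c" "c - a - b"] 
    by (auto simp: algebra_simps)
  moreover have "\<not> m dvd b - a" "\<not> m dvd c - a" "\<not> m dvd c - b"
    using ne by (metis dvd_diff_commute)+
  ultimately consider "\<not> m dvd b - a - c" "\<not> m dvd c - a - b"
    | "\<not> m dvd a - b - c" "\<not> m dvd c - a - b"
    | "\<not> m dvd a - b - c" "\<not> m dvd b - a - c"
    by blast
  then show ?thesis
  proof cases
    case 1
    then show ?thesis using card_subsums_triple_aux[of m a b c] zsf ne by simp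
  next
    case 2
    have "{#b, a, c#} = {#a, b, c#}" by simp
    from card_subsums_triple_aux[of m b a c, unfolded this] show ?thesis
      using 2 zsf ne \<open>\<not> m dvd b - a\<close> by (simp add: diff_diff_eq add.commute)
  next
    case 3
    have "{#c, a, b#} = {#a, b, c#}" by simp
    from card_subsums_triple_aux[of m c a b, unfolded this] show ?thesis
      using 3 zsf ne \<open>\<not> m dvd c - a\<close> \<open>\<not> m dvd c - b\<close> by (simp add: diff_diff_eq add.commute)
  qed
qed

text \<open>The sums \<open>a + a\<close> and \<open>b + b\<close> are left out of the list: they
  may coincide with \<open>b\<close>, with \<open>a\<close>, or with each other. Seven is one more
  than the general bound of size plus width.\<close>

lemma card_subsums_two_pairs:
  assumes zsf: "zero_sum_free m {#a, a, b, b#}" and ne: "\<not> m dvd a - b"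
  shows "7 \<le> card (subsums m {#a, a, b, b#})"
proof -
  let ?Us = "[{#}, {#a#}, {#b#}, {#a, b#}, {#a, a, b#}, {#a, b, b#}, {#a, a, b, b#}]"
  note nz = zero_sum_freeD[OF zsf, of "{#a#}"] zero_sum_freeD[OF zsf, of "{#b#}"]
    zero_sum_freeD[OF zsf, of "{#a, a#}"] zero_sum_freeD[OF zsf, of "{#b, b#}"]
    zero_sum_freeD[OF zsf, of "{#a, b#}"] zero_sum_freeD[OF zsf, of "{#a, a, b#}"]
    zero_sum_freeD[OF zsf, of "{#a, b, b#}"] zero_sum_freeD[OF zsf, of "{#a, a, b, b#}"]
  have "length ?Us \<le> card (subsums m {#a, a, b, b#})"
  proof (rule card_subsums_ge)
    have "\<not> m dvd b - a"
      using ne by (metis dvd_diff_commute)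
    then show "sorted_wrt (\<lambda>U V. \<not> m dvd \<Sum>\<^sub># V - \<Sum>\<^sub># U) ?Us"
      using nz ne by (simp add: algebra_simps)
  qed auto
  then show ?thesis by simp
qed

section \<open>Lower bounds for the number of subsums\<close>

text \<open>Its cardinality is the width modulo \<open>m\<close>. Distinct integers in
  \<open>T\<close> may become congruent once the modulus is halved, so \<open>set_mset T\<close>
  itself would overcount.\<close>

definition residues_mod :: "int \<Rightarrow> int multiset \<Rightarrow> int set" where
  "residues_mod m T = (\<lambda>x. x mod m) ` set_mset T"

lemma finite_residues_mod [simp]: "finite (residues_mod m T)"
  by (simp add: residues_mod_def)

lemma card_residues_mod_remove: "card (residues_mod m T) \<le> card (residues_mod m (T - {#x#})) + 1"
proof -
  have "residues_mod m T \<subseteq> insert (x mod m) (residues_mod m (T - {#x#}))"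
    by (auto simp: residues_mod_def image_iff in_diff_count split: if_splits)
  then have "card (residues_mod m T) \<le> card (insert (x mod m) (residues_mod m (T - {#x#})))"
    by (intro card_mono) auto
  also have "\<dots> \<le> card (residues_mod m (T - {#x#})) + 1"
    by (simp add: card_insert_if)
  finally show ?thesis .
qed

lemma card_subsums_remove_two:
  assumes "zero_sum_free m T" "card (residues_mod m T) \<ge> 2"
  obtains z where "z \<in># T" "card (subsums m (T - {#z#})) + 2 \<le> card (subsums m T)"
proof -
  obtain u v where "u \<in> residues_mod m T" "v \<in> residues_mod m T" "u \<noteq> v"
    using assms(2) by (metis card_le_Suc0_iff_eq finite_residues_mod not_less_eq_eq numeral_2_eq_2)
  then obtain x y where "x \<in># T" "y \<in># T" "\<not> m dvd x - y"
    by (auto simp: residues_mod_def mod_eq_dvd_iff)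
  then show ?thesis
    using card_subsums_remove_either[OF assms(1), of x y] that by blast
qed

lemma card_subsums_empty [simp]: "card (subsums m {#}) = 1"
  by (simp add: subsums_def)

text \<open>As long as two residues are present, some removal loses two subsums while size and width
  drop by at most one each. With at most one residue left, one subsum per element besides the empty
  one suffices.\<close>

lemma card_subsums_lower_bound:
  assumes "zero_sum_free m T"
  shows "size T + card (residues_mod m T) \<le> card (subsums m T)"
  using assms
proof (induction "size T" arbitrary: T rule: less_induct)
  case less
  show ?case
  proof (cases "card (residues_mod m T) \<ge> 2")
    case True
    then obtain z where z: "z \<in># T" "card (subsums m (T - {#z#})) + 2 \<le> card (subsums m T)"
      using card_subsums_remove_two[OF less.prems] by blast
    have sz: "size T = Suc (size (T - {#z#}))"
      using z(1) by (metis insert_DiffM size_add_mset)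
    have "zero_sum_free m (T - {#z#})"
      using less.prems by (rule zero_sum_free_mono) simp
    then show ?thesis
      using less.hyps[of "T - {#z#}"] sz z(2) card_residues_mod_remove[of m T z] by linarith
  next
    case False
    then show ?thesis
      using card_subsums_mono[OF less.prems, of "{#}"] by simp
  qed
qed

text \<open>The same induction, stopped at width three: there a triple of incongruent elements
  already has 7 = 3 + 3 + 1 subsums, and each further element adds at least one.\<close>

lemma card_subsums_lower_bound_no_order_two:
  assumes "zero_sum_free m T" "card (residues_mod m T) \<ge> 3" "\<And>z. z \<in># T \<Longrightarrow> \<not> m dvd 2 * z"
  shows "size T + card (residues_mod m T) + 1 \<le> card (subsums m T)"
  using assms
proof (induction "size T" arbitrary: T rule: less_induct)
  case less
  show ?case
  proof (cases "card (residues_mod m T) \<ge> 4")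
    case True
    then obtain z where z: "z \<in># T" "card (subsums m (T - {#z#})) + 2 \<le> card (subsums m T)"
      using card_subsums_remove_two[OF less.prems(1)] by auto
    have sz: "size T = Suc (size (T - {#z#}))"
      using z(1) by (metis insert_DiffM size_add_mset)
    have "zero_sum_free m (T - {#z#})"
      using less.prems(1) by (rule zero_sum_free_mono) simp
    then show ?thesis
      using less.hyps[of "T - {#z#}"] sz z(2) card_residues_mod_remove[of m T z] True less.prems(3)
      by (fastforce dest: in_diffD)
  next
    case False
    then have "card (residues_mod m T) = 3"
      using less.prems(2) by simp
    then obtain u v w where uvw: "residues_mod m T = {u, v, w}" "u \<noteq> v" "u \<noteq> w" "v \<noteq> w"
      by (auto simp: card_3_iff)
    then have "u \<in> residues_mod m T" "v \<in> residues_mod m T" "w \<in> residues_mod m T"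
      by auto
    then obtain a b c where abc: "a \<in># T" "b \<in># T" "c \<in># T" "u = a mod m" "v = b mod m" "w = c mod m"
      by (auto simp: residues_mod_def)
    then have "a \<noteq> b" "a \<noteq> c" "b \<noteq> c"
      using uvw by auto
    then have sub: "{#a, b, c#} \<subseteq># T"
      using abc by (auto simp: subseteq_mset_def)
    then have "7 \<le> card (subsums m {#a, b, c#})"
      using less.prems(1,3) abc uvw 
      by (intro card_subsums_triple) (auto simp: mod_eq_dvd_iff intro: zero_sum_free_mono)
    then show ?thesis
      using card_subsums_mono[OF less.prems(1) sub] \<open>card (residues_mod m T) = 3\<close> by simp
  qed
qed

text \<open>With \<open>m = 2 * n\<close>, the element \<open>z\<close> generates the subgroup of
  order two, and the quotient is the integers modulo \<open>n\<close>. The general bound applies to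
  \<open>T\<close> there, and every subsum modulo \<open>n\<close> has two lifts modulo
  \<open>m\<close>, both reached with the help of \<open>z\<close>.\<close>

lemma card_subsums_lower_bound_order_two:
  assumes "m > 0" and zsf: "zero_sum_free m (add_mset z T)" and z: "m dvd 2 * z" and "size T \<ge> 3"
  shows "size (add_mset z T) + card (residues_mod m (add_mset z T)) + 1 \<le> card (subsums m (add_mset z T))"
proof -
  have nz: "\<not> m dvd z"
    using zero_sum_freeD[OF zsf, of "{#z#}"] by simp
  have "even m"
    using z nz by (metis coprime_dvd_mult_right_iff coprime_right_2_iff_odd)
  then obtain n where n: "m = 2 * n" by blast
  with z obtain k where k: "z = n * k"
    by auto
  have "odd k"
  proof
    assume "even k"
    then obtain l where "k = 2 * l" by blast
    then have "z = m * l" using k n by simp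
    then show False using nz by simp
  qed
  \<comment> \<open>As \<open>k\<close> is odd, \<open>z\<close> is congruent to \<open>n\<close>
    modulo \<open>m\<close>; hence 0 and \<open>z\<close> represent all multiples of
    \<open>n\<close> modulo \<open>m\<close>.\<close>
  have ndvd: "m dvd v \<or> m dvd v - z" if v: "n dvd v" for v
  proof -
    obtain j where j: "v = n * j" using v by blast
    have "even j \<or> even (j - k)" using \<open>odd k\<close> by auto
    then have "2 * n dvd j * n \<or> 2 * n dvd (j - k) * n"
      using mult_dvd_mono[OF _ dvd_refl[of n]] by blast
    then show ?thesis
      by (simp add: j n k algebra_simps)
  qed
  have plus_z: "m dvd v + z" if "m dvd v - z" for v
    using dvd_add[OF that z] by (simp add: add.commute)
  have "n > 0" using n \<open>m > 0\<close> by simp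
  have sub: "add_mset z U \<subseteq># add_mset z T" if "U \<subseteq># T" for U
    using that by simp
  have subT: "U \<subseteq># add_mset z T" if "U \<subseteq># T" for U
    using that by (auto simp: subseteq_mset_def le_SucI)
  \<comment> \<open>\<open>T\<close> is still zero-sum free in the quotient by the subgroup \<open>{0, z}\<close>.\<close>
  have "zero_sum_free n T"
    unfolding zero_sum_free_def
  proof (intro allI impI notI)
    fix U assume U: "U \<subseteq># T" "U \<noteq> {#}" "n dvd \<Sum>\<^sub># U"
    have "\<not> m dvd \<Sum>\<^sub># U"
      using zero_sum_freeD[OF zsf subT[OF U(1)] U(2)] .
    moreover have "\<not> m dvd \<Sum>\<^sub># U + z"
      using zero_sum_freeD[OF zsf sub[OF U(1)]] by (simp add: add.commute)
    ultimately show False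
      using ndvd[OF U(3)] plus_z by blast
  qed
  then have lb: "size T + card (residues_mod n T) \<le> card (subsums n T)"
    by (rule card_subsums_lower_bound)
  have double: "card (A \<union> (\<lambda>s. s + n) ` A) = 2 * card A" if "A \<subseteq> {0..<n}" for A
  proof -
    have fin: "finite A" using that finite_subset by blast
    have "s + n \<notin> A" if "s \<in> A" for s
      using subsetD[OF \<open>A \<subseteq> {0..<n}\<close>, of s] subsetD[OF \<open>A \<subseteq> {0..<n}\<close>, of "s + n"] that by auto
    then have "A \<inter> (\<lambda>s. s + n) ` A = {}" by auto
    then have "card (A \<union> (\<lambda>s. s + n) ` A) = card A + card ((\<lambda>s. s + n) ` A)"
      using fin by (intro card_Un_disjoint) auto
    then show ?thesis by (simp add: card_image)
  qed
  \<comment> \<open>Any lift of a subsum of \<open>T\<close> modulo \<open>n\<close> differs from it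
    by 0 or \<open>z\<close> modulo \<open>m\<close>, and in the latter case \<open>z\<close> is
    adjoined to \<open>U\<close>.\<close>
  have in_subsums: "t mod m \<in> subsums m (add_mset z T)" if U: "U \<subseteq># T" "n dvd t - \<Sum>\<^sub># U" for t U
  proof -
    consider "m dvd t - \<Sum>\<^sub># U" | "m dvd t - \<Sum>\<^sub># U - z"
      using ndvd[OF U(2)] by blast
    then show ?thesis
    proof cases
      case 1
      then show ?thesis using subT[OF U(1)] by (auto simp: mem_subsums_iff)
    next
      case 2
      then show ?thesis using sub[OF U(1)] unfolding mem_subsums_iff
        by (intro exI[of _ "add_mset z U"]) (simp add: algebra_simps)
    qed
  qed
  have "2 * card (subsums n T) = card (subsums n T \<union> (\<lambda>s. s + n) ` subsums n T)"
    using \<open>n > 0\<close> by (intro double[symmetric]) (auto simp: subsums_def)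
  also have "\<dots> \<le> card (subsums m (add_mset z T))"
  proof (rule card_mono)
    show "subsums n T \<union> (\<lambda>s. s + n) ` subsums n T \<subseteq> subsums m (add_mset z T)"
    proof -
      have "\<Sum>\<^sub># U mod n \<in> subsums m (add_mset z T)" "\<Sum>\<^sub># U mod n + n \<in> subsums m (add_mset z T)"
        if "U \<subseteq># T" for U
      proof -
        have "0 \<le> \<Sum>\<^sub># U mod n" "\<Sum>\<^sub># U mod n < n" using \<open>n > 0\<close> by auto
        then have "(\<Sum>\<^sub># U mod n) mod m = \<Sum>\<^sub># U mod n" "(\<Sum>\<^sub># U mod n + n) mod m = \<Sum>\<^sub># U mod n + n"
          using n by auto
        moreover have "n dvd \<Sum>\<^sub># U mod n - \<Sum>\<^sub># U" "n dvd \<Sum>\<^sub># U mod n + n - \<Sum>\<^sub># U"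
          by (auto simp flip: mod_eq_dvd_iff)
        ultimately show "\<Sum>\<^sub># U mod n \<in> subsums m (add_mset z T)"
            "\<Sum>\<^sub># U mod n + n \<in> subsums m (add_mset z T)"
          using in_subsums[OF that] by metis+
      qed
      then show ?thesis by (auto simp: subsums_def[of n])
    qed
  qed simp
  finally have "2 * card (subsums n T) \<le> card (subsums m (add_mset z T))" .
  \<comment> \<open>Each residue modulo \<open>n\<close> has two lifts modulo \<open>m\<close>; the
    extra 1 accounts for \<open>z\<close>.\<close>
  moreover have "card (residues_mod m (add_mset z T)) \<le> 1 + 2 * card (residues_mod n T)"
  proof -
    have "residues_mod m T \<subseteq> residues_mod n T \<union> (\<lambda>s. s + n) ` residues_mod n T"
    proof
      fix r assume "r \<in> residues_mod m T"
      then obtain x where x: "x \<in># T" "r = x mod m" by (auto simp: residues_mod_def)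
      have "r mod n = x mod n"
        using x n by (simp add: mod_mod_cancel)
      moreover have "r = r mod n \<or> r = r mod n + n"
      proof -
        have "0 \<le> r" "r < 2 * n" using x n \<open>n > 0\<close> by auto
        then have "r mod n = (if r < n then r else r - n)"
          using minus_mod_self2[of r n] mod_pos_pos_trivial[of "r - n" n] by auto
        then show ?thesis by auto
      qed
      ultimately show "r \<in> residues_mod n T \<union> (\<lambda>s. s + n) ` residues_mod n T"
        using x(1) by (auto simp: residues_mod_def image_iff)
    qed
    then have "card (residues_mod m T) \<le> card (residues_mod n T \<union> (\<lambda>s. s + n) ` residues_mod n T)"
      by (intro card_mono) auto
    also have "\<dots> = 2 * card (residues_mod n T)"
      using \<open>n > 0\<close> by (intro double) (auto simp: residues_mod_def)
    finally show ?thesis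
      using card_residues_mod_remove[of m "add_mset z T" z] by simp
  qed
  \<comment> \<open>With \<open>w\<close> the width of \<open>T\<close> modulo \<open>n\<close>, the
    left side is at most \<open>size T + 3 + 2 * w\<close>, and the right side is at least
    \<open>2 * size T + 2 * w\<close>.\<close>
  ultimately show ?thesis
    using lb \<open>size T \<ge> 3\<close> by simp
qed

lemma card_subsums_lower_bound_strong:
  assumes "m > 0" "zero_sum_free m T" "card (residues_mod m T) \<ge> 3" "size T \<ge> 4"
  shows "size T + card (residues_mod m T) + 1 \<le> card (subsums m T)"
proof (cases "\<exists>z. z \<in># T \<and> m dvd 2 * z")
  case True
  then obtain z U where "T = add_mset z U" "m dvd 2 * z"
    by (meson multi_member_split)
  then show ?thesis
    using card_subsums_lower_bound_order_two[of m z U] assms by simp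
next
  case False
  then show ?thesis
    using card_subsums_lower_bound_no_order_two assms by blast
qed


section \<open>From the group of residues to integer divisibility\<close>

lemma finprod_integer_mod_group:
  assumes "finite A" "f \<in> A \<rightarrow> carrier (integer_mod_group m)"
  shows "finprod (integer_mod_group m) f A = (\<Sum>a\<in>A. f a) mod int m"
proof -
  interpret comm_group "integer_mod_group m"
    by (rule abelian_integer_mod_group)
  show ?thesis
    using assms by (induction A) (simp_all add: Pi_iff mod_add_right_eq)
qed

lemma sum_count_eq_sum_mset:
  assumes "finite A" "set_mset S \<subseteq> A"
  shows "(\<Sum>a\<in>A. int (count S a) * a) = \<Sum>\<^sub># S"
  using assms(2)
proof (induction S)
  case (add x S)
  have "(\<Sum>a\<in>A. int (count (add_mset x S) a) * a)
      = (\<Sum>a\<in>A. int (count S a) * a) + (\<Sum>a\<in>A. if a = x then x else 0)"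
    by (subst sum.distrib[symmetric], intro sum.cong) (auto simp: algebra_simps)
  then show ?case
    using add assms(1) by simp
qed simp

lemma msum_integer_mod_group:
  assumes "m > 0"
  shows "msum (integer_mod_group m) S = \<Sum>\<^sub># S mod int m"
proof -
  have "msum (integer_mod_group m) S = (\<Sum>a\<in>set_mset S. (int (count S a) * a) mod int m) mod int m"
    unfolding msum_def using assms
    by (subst finprod_integer_mod_group) (auto simp: carrier_integer_mod_group)
  also have "\<dots> = \<Sum>\<^sub># S mod int m"
    by (simp add: mod_sum_eq sum_count_eq_sum_mset)
  finally show ?thesis .
qed

text \<open>Moves the problem out of the group: later arguments use only integer representatives and
  divisibility of their sums.\<close>

lemma zero_sum_integer_mod_group:
  assumes "m > 0"
  shows "zero_sum (integer_mod_group m) S \<longleftrightarrow> set_mset S \<subseteq> {0..<int m} \<and> int m dvd \<Sum>\<^sub># S"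
  using assms by (auto simp: zero_sum_def msum_integer_mod_group carrier_integer_mod_group)

lemma size_4_width_3E:
  assumes "size S = 4" "width S = 3"
  obtains a b c where "S = {#a, a, b, c#}" "a \<noteq> b" "a \<noteq> c" "b \<noteq> c"
proof -
  obtain u v w where uvw: "set_mset S = {u, v, w}" "u \<noteq> v" "u \<noteq> w" "v \<noteq> w"
    using assms(2) by (auto simp: width_def card_3_iff)
  then have "{#u, v, w#} \<subseteq># S"
    by (auto simp: subseteq_mset_def)
  then obtain R where R: "S = {#u, v, w#} + R"
    by (auto simp: mset_subset_eq_exists_conv)
  then have "size R = 1"
    using assms(1) by simp
  then obtain d where "R = {#d#}"
    using size_1_singleton_mset by blast
  then have S: "S = {#d, u, v, w#}" "d \<in> {u, v, w}"
    using R uvw(1) by auto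
  from S(2) consider "d = u" | "d = v" | "d = w"
    by blast
  then show thesis
  proof cases
    case 1
    then show ?thesis using that[of u v w] S uvw by simp
  next
    case 2
    then show ?thesis using that[of v u w] S uvw by (simp add: add_mset_commute)
  next
    case 3
    then show ?thesis using that[of w u v] S uvw by (simp add: add_mset_commute)
  qed
qed

text \<open>Exhaustive check over the residues modulo 6. Submultisets of size three are covered by
  their one-element complements, since the total is divisible by 6.\<close>

lemma mod_6_solutions:
  fixes a b c :: int
  assumes "a \<in> {0..5}" "b \<in> {0..5}" "c \<in> {0..5}" "a \<noteq> b" "a \<noteq> c" "b \<noteq> c"
    and "\<not> 6 dvd b" "\<not> 6 dvd c" "\<not> 6 dvd a + a" "\<not> 6 dvd a + b" "\<not> 6 dvd a + c" "\<not> 6 dvd b + c"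
    and "6 dvd a + a + b + c"
  shows "a = 4 \<and> (b = 1 \<and> c = 3 \<or> b = 3 \<and> c = 1) \<or> a = 2 \<and> (b = 3 \<and> c = 5 \<or> b = 5 \<and> c = 3)"
proof -
  have "{0..5} = {0, 1, 2, 3, 4, 5 :: int}"
    by auto
  then have "a \<in> {0, 1, 2, 3, 4, 5}" "b \<in> {0, 1, 2, 3, 4, 5}" "c \<in> {0, 1, 2, 3, 4, 5}"
    using assms(1-3) by auto
  then show ?thesis
    using assms(4-) by (elim insertE emptyE) simp_all
qed

lemma proper_subset_mset_if_size_less:
  "U \<subseteq># S \<Longrightarrow> size U < size S \<Longrightarrow> U \<subset># S"
  by (auto simp: subset_mset.less_le)

section \<open>Minimal zero-sum multisets modulo \<open>m\<close>\<close>

context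
  fixes m :: nat and S :: "int multiset"
  assumes m: "m > 0" and S: "minimal_zero_sum (integer_mod_group m) S"
begin

lemma minimal_zero_sum_range: "x \<in># S \<Longrightarrow> 0 \<le> x \<and> x < int m"
  using S m by (auto simp: minimal_zero_sum_def zero_sum_integer_mod_group)

lemma minimal_zero_sum_dvd: "int m dvd \<Sum>\<^sub># S"
  using S m by (auto simp: minimal_zero_sum_def zero_sum_integer_mod_group)

lemma minimal_zero_sum_not_dvd:
  assumes "U \<subset># S" "U \<noteq> {#}"
  shows "\<not> int m dvd \<Sum>\<^sub># U"
proof -
  have "set_mset U \<subseteq> {0..<int m}"
    using minimal_zero_sum_range assms(1)
    by (metis atLeastLessThan_iff set_mset_mono subset_iff subset_mset.less_imp_le)
  then show ?thesis
    using S m assms by (auto simp: minimal_zero_sum_def zero_sum_integer_mod_group)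
qed

text \<open>Makes the bounds for zero-sum free multisets available: what remains is a proper
  submultiset, and so is each of its submultisets.\<close>

lemma zero_sum_free_remove:
  assumes "x \<in># S"
  shows "zero_sum_free (int m) (S - {#x#})"
  unfolding zero_sum_free_def
proof (intro allI impI)
  fix U assume "U \<subseteq># S - {#x#}" "U \<noteq> {#}"
  moreover have "S - {#x#} \<subset># S"
    using assms by (metis add_mset_remove_trivial_eq diff_subset_eq_self insert_DiffM multi_self_add_other_not_self
        subset_mset.less_le)
  ultimately show "\<not> int m dvd \<Sum>\<^sub># U"
    using minimal_zero_sum_not_dvd subset_mset.le_less_trans by blast
qed

lemma card_residues_mod_eq_width:
  assumes "set_mset T \<subseteq> set_mset S"
  shows "card (residues_mod (int m) T) = width T"
proof -
  have "residues_mod (int m) T = id ` set_mset T"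
    unfolding residues_mod_def using minimal_zero_sum_range assms by (intro image_cong) auto
  then show ?thesis
    by (simp add: width_def)
qed

text \<open>If \<open>x\<close> and its negative both occur and differ, they form a proper zero-sum
  pair. So \<open>?X\<close> and \<open>?Y\<close> share at most the class of \<open>m / 2\<close>,
  and their union consists of nonzero classes, whence
  \<open>2 * width S - 1 \<le> m - 1\<close>.\<close>

lemma two_width_le:
  assumes "width S \<ge> 3"
  shows "2 * width S \<le> m"
proof -
  let ?X = "set_mset S" and ?Y = "(\<lambda>x. int m - x) ` set_mset S"
  have "size S \<ge> 3"
    using assms unfolding width_def size_eq_sum_mset
    by (metis (no_types) le_trans size_eq_sum_mset size_multiset_overloaded_def size_mset_set
        finite_set_mset mset_set_set_mset_msubset size_mset_mono)
  have "?X \<subseteq> {1..<int m}"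
  proof
    fix x assume x: "x \<in># S"
    then have "\<not> int m dvd x"
      using minimal_zero_sum_not_dvd[of "{#x#}"] proper_subset_mset_if_size_less[of "{#x#}" S]
        \<open>size S \<ge> 3\<close> by auto
    then have "x \<noteq> 0" by auto
    then show "x \<in> {1..<int m}"
      using minimal_zero_sum_range[OF x] by auto
  qed
  then have "?X \<union> ?Y \<subseteq> {1..<int m}"
    by fastforce
  from card_mono[OF _ this] have un: "card (?X \<union> ?Y) \<le> m - 1"
    by simp
  have "2 * x = int m" if x: "x \<in> ?X \<inter> ?Y" for x
  proof (rule ccontr)
    assume ne: "2 * x \<noteq> int m"
    obtain y where y: "x \<in># S" "y \<in># S" "x = int m - y"
      using x by auto
    then have "{#x, y#} \<subseteq># S"
      using ne by (auto simp: subseteq_mset_def)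
    then show False
      using minimal_zero_sum_not_dvd[of "{#x, y#}"] y(3) \<open>size S \<ge> 3\<close>
        proper_subset_mset_if_size_less[of "{#x, y#}" S] by simp
  qed
  then have "card (?X \<inter> ?Y) \<le> 1"
    by (subst One_nat_def, subst card_le_Suc0_iff_eq) (simp, smt (verit))
  moreover have "card ?X + card ?Y = card (?X \<union> ?Y) + card (?X \<inter> ?Y)"
    by (intro card_Un_Int) auto
  moreover have "card ?Y = card ?X"
    by (intro card_image inj_onI) auto
  ultimately show ?thesis
    using un m by (simp add: width_def)
qed

lemma size_add_width_le:
  assumes "width S \<ge> 3"
  shows "size S + width S \<le> m \<or> size S = 4 \<and> width S = 3"
proof (cases "\<exists>x. count S x \<ge> 2")
  case True
  then obtain x where x: "count S x \<ge> 2" by blast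
  then have xS: "x \<in># S"
    by (simp flip: count_greater_zero_iff)
  have set: "set_mset (S - {#x#}) = set_mset S"
    using x by (auto simp: in_diff_count dest: in_diffD)
  then have width: "width (S - {#x#}) = width S"
    by (simp add: width_def)
  have sz: "size S = Suc (size (S - {#x#}))"
    using xS by (metis insert_DiffM size_add_mset)
  \<comment> \<open>If at most three elements remain, this forces width 3 and size 4, the
    exceptional alternative.\<close>
  have "width S \<le> size (S - {#x#})"
    unfolding width_def set[symmetric]
    by (metis finite_set_mset mset_set_set_mset_msubset size_mset_mono size_mset_set)
  \<comment> \<open>The extra 1 in the strong bound makes up for the removed copy of
    \<open>x\<close>.\<close>
  moreover have "size S + width S \<le> m" if "size (S - {#x#}) \<ge> 4"
    using card_subsums_lower_bound_strong[OF _ zero_sum_free_remove[OF xS] _ that]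
      card_subsums_le[of "int m" "S - {#x#}"] card_residues_mod_eq_width[of "S - {#x#}"] 
      set width sz assms m by simp
  ultimately show ?thesis
    using sz assms by linarith
next
  case False
  then have "S \<subseteq># mset_set (set_mset S)"
    by (auto simp: subseteq_mset_def count_mset_set' not_in_iff not_less_eq_eq numeral_2_eq_2)
  then have "size S \<le> width S"
    unfolding width_def by (metis size_mset_mono size_mset_set)
  then show ?thesis
    using two_width_le[OF assms] by simp
qed

lemma exceptional_if_mod_6:
  assumes "m = 6" "size S = 4" "width S = 3"
  shows "S = {#1, 3, 4, 4#} \<or> S = {#2, 2, 3, 5#}"
proof -
  obtain a b c where abc: "S = {#a, a, b, c#}" "a \<noteq> b" "a \<noteq> c" "b \<noteq> c"
    using assms(2,3) by (rule size_4_width_3E)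
  have nd: "\<not> 6 dvd \<Sum>\<^sub># U" if "U \<subseteq># S" "U \<noteq> {#}" "size U < 4" for U
    using minimal_zero_sum_not_dvd[of U] proper_subset_mset_if_size_less[of U S] that assms(1,2) by simp
  have "\<not> 6 dvd b" "\<not> 6 dvd c" "\<not> 6 dvd a + a" "\<not> 6 dvd a + b" "\<not> 6 dvd a + c" "\<not> 6 dvd b + c"
    using nd[of "{#b#}"] nd[of "{#c#}"] nd[of "{#a, a#}"] nd[of "{#a, b#}"] nd[of "{#a, c#}"]
      nd[of "{#b, c#}"] by (simp_all add: abc(1))
  moreover have "6 dvd a + a + b + c"
    using minimal_zero_sum_dvd by (simp add: abc(1) assms(1) add.assoc)
  moreover have "a \<in> {0..5}" "b \<in> {0..5}" "c \<in> {0..5}"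
    using minimal_zero_sum_range assms(1) by (force simp: abc(1))+
  ultimately have "a = 4 \<and> (b = 1 \<and> c = 3 \<or> b = 3 \<and> c = 1) \<or> a = 2 \<and> (b = 3 \<and> c = 5 \<or> b = 5 \<and> c = 3)"
    using abc(2-4) by (intro mod_6_solutions) auto
  then show ?thesis
    by (auto simp: abc(1))
qed

text \<open>For width one the multiplicity is \<open>m\<close>. For width two, if the claim fails,
  both elements occur at least twice; a third copy of either would yield too many subsums, which
  leaves two copies of each and \<open>m = 5\<close>.\<close>

lemma ex_count_ge:
  assumes "m \<ge> 3" "width S \<le> 2" "size S + width S = m + 1"
  shows "\<exists>a. a \<in># S \<and> count S a \<ge> m - 2"
proof -
  have "S \<noteq> {#}"
    using S by (simp add: minimal_zero_sum_def)
  then have "width S \<noteq> 0"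
    by (simp add: width_def)
  with assms(2) consider "width S = 1" | "width S = 2"
    by linarith
  then show ?thesis
  proof cases
    case 1
    then obtain a where "set_mset S = {a}"
      by (auto simp: width_def card_1_singleton_iff)
    then show ?thesis
      using 1 assms(3) by (auto simp: size_multiset_overloaded_eq)
  next
    case 2
    then obtain a b where ab: "set_mset S = {a, b}" "a \<noteq> b"
      by (auto simp: width_def card_2_iff)
    have size: "size S = count S a + count S b" "size S = m - 1"
      using ab assms(3) 2 by (simp_all add: size_multiset_overloaded_eq)
    show ?thesis
    proof (rule ccontr)
      assume "\<not> ?thesis"
      then have "count S x < m - 2" if "x \<in># S" for x
        using that by (meson not_le)
      then have "count S a < m - 2" "count S b < m - 2"
        by (simp_all add: ab(1))
      \<comment> \<open>The multiplicities add up to \<open>m - 1\<close>, so when one is below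
        \<open>m - 2\<close> the other is at least 2.\<close>
      then have two: "count S a \<ge> 2" "count S b \<ge> 2"
        using size by linarith+
      have "\<not> int m dvd a - b"
        using minimal_zero_sum_range[of a] minimal_zero_sum_range[of b] ab
        by (metis insertI1 insertI2 mod_eq_dvd_iff mod_pos_pos_trivial)
      have False if x: "x \<in># S" "{#a, a, b, b#} \<subseteq># S - {#x#}" for x
      proof -
        have zsf: "zero_sum_free (int m) (S - {#x#})"
          using x(1) by (rule zero_sum_free_remove)
        \<comment> \<open>The other \<open>m - 6\<close> elements of \<open>S - {#x#}\<close>
          contribute one subsum each, which makes at least \<open>m + 1\<close> residues modulo
          \<open>m\<close>.\<close>
        have "7 \<le> card (subsums (int m) {#a, a, b, b#})"
          using zero_sum_free_mono[OF zsf x(2)] \<open>\<not> int m dvd a - b\<close> by (rule card_subsums_two_pairs)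
        moreover have "size S = Suc (size (S - {#x#}))"
          using x(1) by (metis insert_DiffM size_add_mset)
        ultimately show False
          using card_subsums_mono[OF zsf x(2)] card_subsums_le[of "int m" "S - {#x#}"] size m by simp
      qed
      moreover have "{#a, a, b, b#} \<subseteq># S - {#a#}" if "count S a \<ge> 3"
        using that two ab by (auto simp: subseteq_mset_def)
      moreover have "{#a, a, b, b#} \<subseteq># S - {#b#}" if "count S b \<ge> 3"
        using that two ab by (auto simp: subseteq_mset_def)
      ultimately have "count S a = 2" "count S b = 2"
        using two ab by (fastforce simp: not_le)+
      then have "S = {#a, a, b, b#}" "m = 5"
        using ab size by (auto simp: multiset_eq_iff not_in_iff[symmetric])
      \<comment> \<open>Since 2 is invertible modulo 5, the pair of \<open>a\<close> and
        \<open>b\<close> already has sum zero.\<close>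
      then have "5 dvd 2 * (a + b)"
        using minimal_zero_sum_dvd by (simp add: algebra_simps)
      then have "5 dvd a + b"
        by presburger
      then show False
        using minimal_zero_sum_not_dvd[of "{#a, b#}"] \<open>S = {#a, a, b, b#}\<close> \<open>m = 5\<close>
          proper_subset_mset_if_size_less[of "{#a, b#}" S] by simp
    qed
  qed
qed

end

text \<open>The exception in (i) is stated as an equivalence, which also asserts that both
  exceptional multisets have width above two. The bound in (iii) is over the integers, so that the
  subtraction is not truncated.\<close>

theorem corollary3:
  fixes m :: nat and S :: "int multiset"
  assumes "m \<ge> 2"
    and "minimal_zero_sum (integer_mod_group m) S"
  shows "(size S + width S = m + 1 \<longrightarrow>
            (width S \<le> 2 \<longleftrightarrow> \<not> (m = 6 \<and> (S = {#1, 3, 4, 4#} \<or> S = {#2, 2, 3, 5#}))))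
       \<and> (m \<ge> 3 \<and> m \<noteq> 6 \<and> size S + width S = m + 1 \<longrightarrow>
            (\<exists>a. a \<in># S \<and> count S a \<ge> m - 2))
       \<and> (m \<ge> 7 \<and> width S \<ge> 3 \<longrightarrow> int (size S) \<le> int m - int (width S))"
proof (intro conjI impI)
  have m: "m > 0" using assms(1) by simp
  note S = assms(2)
  have width_le: "width S \<le> 2"
    if "size S + width S = m + 1" "\<not> (m = 6 \<and> (S = {#1, 3, 4, 4#} \<or> S = {#2, 2, 3, 5#}))"
  proof (rule ccontr)
    assume "\<not> width S \<le> 2"
    \<comment> \<open>Size plus width exceeds \<open>m\<close>, so only the exceptional alternative
      is left, and 4 + 3 = \<open>m + 1\<close> determines \<open>m\<close>.\<close>
    then have "size S = 4" "width S = 3" "m = 6"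
      using size_add_width_le[OF m S] that(1) by auto
    then show False
      using exceptional_if_mod_6[OF m S] that(2) by blast
  qed
  show "width S \<le> 2 \<longleftrightarrow> \<not> (m = 6 \<and> (S = {#1, 3, 4, 4#} \<or> S = {#2, 2, 3, 5#}))"
    if "size S + width S = m + 1"
    using width_le[OF that] by (auto simp: width_def)
  show "\<exists>a. a \<in># S \<and> count S a \<ge> m - 2" if "m \<ge> 3 \<and> m \<noteq> 6 \<and> size S + width S = m + 1"
    using ex_count_ge[OF m S] width_le that by blast
  \<comment> \<open>In the alternative of size 4 and width 3 the bound holds because
    \<open>m\<close> is at least 7.\<close>
  show "int (size S) \<le> int m - int (width S)" if "m \<ge> 7 \<and> width S \<ge> 3"
    using size_add_width_le[OF m S] that by auto
qed

end
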